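(* For any positive integer $k$, every Eulerian graph is $2k$-flow-connected.
   Context: Graphs are finite; parallel edges are allowed. A graph is Eulerian if every vertex has even degree (connectedness is not required). A cycle is a connected 2-regular graph (two parallel edges form a cycle of length 2). Fix an arbitrary orientation $D$ of $G$; for a vertex $v$ let $E_D^+(v)$ and $E_D^-(v)$ be the sets of edges directed out of and into $v$. For a positive integer $m$, an $m$-flow (always nowhere-zero) is a function $f:E(G)\to\mathbb{Z}$ with $0<|f(e)|<m$ for all edges $e$ and $\sum_{e\in E_D^+(v)}f(e)=\sum_{e\in E_D^-(v)}f(e)$ for every vertex $v$. (Flows given with different orientations are identified by negating the value of every edge whose orientation is reversed, so the choice of $D$ does not matter.) Two $m$-flows $f',f''$ are $m$-flow-adjacent if there is a cycle $C$ in $G$ such that $f'(e)=f''(e)$ for all $e\notin E(C)$, and $m$-flow-equivalent if they are joined by a finite sequence of $m$-flows in which consecutive ones are $m$-flow-adjacent. $G$ is $m$-flow-connected if all its $m$-flows are pairwise $m$-flow-equivalent. *)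

theory Defs
  imports "Graph_Theory.Digraph"
begin

text \<open>
  Finite undirected multigraphs: edges have an identity of their own, so distinct edges may share
  their set of ends. Loops are excluded, as every edge has two distinct ends.
\<close>

record ('v, 'e) pre_multigraph =
  mverts :: "'v set"
  medges :: "'e set"
  mends :: "'e \<Rightarrow> 'v set"

definition multigraph :: "('v, 'e) pre_multigraph \<Rightarrow> bool" where
  "multigraph G \<longleftrightarrow> finite (mverts G) \<and> finite (medges G) \<and>
     (\<forall>e\<in>medges G. mends G e \<subseteq> mverts G \<and> card (mends G e) = 2)"

definition mdegree :: "('v, 'e) pre_multigraph \<Rightarrow> 'v \<Rightarrow> nat" where
  "mdegree G v = card {e \<in> medges G. v \<in> mends G e}"

definition eulerian :: "('v, 'e) pre_multigraph \<Rightarrow> bool" where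
  "eulerian G \<longleftrightarrow> (\<forall>v\<in>mverts G. even (mdegree G v))"

definition madjacent :: "('v, 'e) pre_multigraph \<Rightarrow> 'v \<Rightarrow> 'v \<Rightarrow> bool" where
  "madjacent G u v \<longleftrightarrow> (\<exists>e\<in>medges G. mends G e = {u, v})"

definition mconnected :: "('v, 'e) pre_multigraph \<Rightarrow> bool" where
  "mconnected G \<longleftrightarrow> mverts G \<noteq> {} \<and> (\<forall>u\<in>mverts G. \<forall>v\<in>mverts G. (madjacent G)\<^sup>*\<^sup>* u v)"

definition msubgraph :: "('v, 'e) pre_multigraph \<Rightarrow> ('v, 'e) pre_multigraph \<Rightarrow> bool" where
  "msubgraph H G \<longleftrightarrow> multigraph H \<and> mverts H \<subseteq> mverts G \<and> medges H \<subseteq> medges G \<and>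
     (\<forall>e\<in>medges H. mends H e = mends G e)"

definition mcycle :: "('v, 'e) pre_multigraph \<Rightarrow> bool" where
  "mcycle C \<longleftrightarrow> multigraph C \<and> mconnected C \<and> (\<forall>v\<in>mverts C. mdegree C v = 2)"

definition orientation :: "('v, 'e) pre_multigraph \<Rightarrow> ('v, 'e) pre_digraph \<Rightarrow> bool" where
  "orientation G D \<longleftrightarrow> verts D = mverts G \<and> arcs D = medges G \<and>
     (\<forall>e\<in>medges G. mends G e = {tail D e, head D e})"

text \<open>
  A flow is a function on the edge set only. It is represented by a total function that is 0
  outside the edge set, so that equality of functions is equality of flows.
\<close>

definition mflow ::
  "nat \<Rightarrow> ('v, 'e) pre_multigraph \<Rightarrow> ('v, 'e) pre_digraph \<Rightarrow> ('e \<Rightarrow> int) \<Rightarrow> bool" where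
  "mflow m G D f \<longleftrightarrow>
     (\<forall>e\<in>medges G. 0 < \<bar>f e\<bar> \<and> \<bar>f e\<bar> < int m) \<and>
     (\<forall>e. e \<notin> medges G \<longrightarrow> f e = 0) \<and>
     (\<forall>v\<in>mverts G. (\<Sum>e\<in>out_arcs D v. f e) = (\<Sum>e\<in>in_arcs D v. f e))"

definition flow_adjacent ::
  "nat \<Rightarrow> ('v, 'e) pre_multigraph \<Rightarrow> ('v, 'e) pre_digraph \<Rightarrow> ('e \<Rightarrow> int) \<Rightarrow> ('e \<Rightarrow> int) \<Rightarrow> bool" where
  "flow_adjacent m G D f f' \<longleftrightarrow> mflow m G D f \<and> mflow m G D f' \<and>
     (\<exists>C. msubgraph C G \<and> mcycle C \<and> (\<forall>e\<in>medges G - medges C. f e = f' e))"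

definition flow_equivalent ::
  "nat \<Rightarrow> ('v, 'e) pre_multigraph \<Rightarrow> ('v, 'e) pre_digraph \<Rightarrow> ('e \<Rightarrow> int) \<Rightarrow> ('e \<Rightarrow> int) \<Rightarrow> bool" where
  "flow_equivalent m G D f f' \<longleftrightarrow> mflow m G D f \<and> mflow m G D f' \<and>
     (flow_adjacent m G D)\<^sup>*\<^sup>* f f'"

text \<open>
  Flow-connectedness is required for every orientation. By \<open>flow_connected_iff\<close> below this is the
  same as requiring it for a single, arbitrarily chosen one.
\<close>

definition flow_connected :: "nat \<Rightarrow> ('v, 'e) pre_multigraph \<Rightarrow> bool" where
  "flow_connected m G \<longleftrightarrow> (\<forall>D. orientation G D \<longrightarrow>
     (\<forall>f f'. mflow m G D f \<and> mflow m G D f' \<longrightarrow> flow_equivalent m G D f f'))"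

lemma orientation_exists:
  assumes "multigraph G"
  shows "\<exists>D. orientation G D"
proof -
  have "\<forall>e\<in>medges G. \<exists>p. mends G e = {fst p, snd p}"
    using assms by (fastforce simp: multigraph_def card_2_iff)
  then obtain p where p: "\<forall>e\<in>medges G. mends G e = {fst (p e), snd (p e)}" by metis
  then show ?thesis
    by (intro exI[of _ "\<lparr>verts = mverts G, arcs = medges G, tail = fst \<circ> p, head = snd \<circ> p\<rparr>"])
      (simp add: orientation_def)
qed

text \<open>Negating the values on the edges whose direction differs in the two orientations.\<close>

definition reorient ::
  "('v, 'e) pre_digraph \<Rightarrow> ('v, 'e) pre_digraph \<Rightarrow> ('e \<Rightarrow> int) \<Rightarrow> 'e \<Rightarrow> int" where
  "reorient D D' f = (\<lambda>e. if tail D e = tail D' e then f e else - f e)"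

lemma reorient_reorient [simp]: "reorient D' D (reorient D D' f) = f"
  by (auto simp: reorient_def)

lemma mflow_reorient:
  assumes G: "multigraph G" and D: "orientation G D" and D': "orientation G D'"
    and f: "mflow m G D f"
  shows "mflow m G D' (reorient D D' f)"
proof -
  have net: "(\<Sum>e\<in>out_arcs H v. g e) - (\<Sum>e\<in>in_arcs H v. g e) =
      (\<Sum>e\<in>medges G. (if tail H e = v then g e else 0) - (if head H e = v then g e else 0))"
    if "orientation G H" for H v and g :: "_ \<Rightarrow> int"
  proof -
    have "finite (medges G)" "arcs H = medges G"
      using G that by (auto simp: multigraph_def orientation_def)
    then show ?thesis
      by (simp add: out_arcs_def in_arcs_def sum_subtractf sum.inter_filter)
  qed
  have ends: "(tail D' e = tail D e \<and> head D' e = head D e) \<or>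
      (tail D' e = head D e \<and> head D' e = tail D e \<and> tail D e \<noteq> tail D' e)"
    if "e \<in> medges G" for e
  proof -
    have "{tail D e, head D e} = {tail D' e, head D' e}" "card {tail D e, head D e} = 2"
      using that G D D' by (auto simp: multigraph_def orientation_def)
    then show ?thesis by (auto simp: doubleton_eq_iff card_insert_if split: if_splits)
  qed
  have "(\<Sum>e\<in>out_arcs D' v. reorient D D' f e) - (\<Sum>e\<in>in_arcs D' v. reorient D D' f e) =
      (\<Sum>e\<in>out_arcs D v. f e) - (\<Sum>e\<in>in_arcs D v. f e)" for v
    unfolding net[OF D] net[OF D']
  proof (rule sum.cong[OF refl])
    fix e assume "e \<in> medges G"
    from ends[OF this] show
      "(if tail D' e = v then reorient D D' f e else 0) -
         (if head D' e = v then reorient D D' f e else 0) =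
       (if tail D e = v then f e else 0) - (if head D e = v then f e else 0)"
      by (elim disjE conjE) (simp_all add: reorient_def)
  qed
  then have "(\<Sum>e\<in>out_arcs D' v. reorient D D' f e) = (\<Sum>e\<in>in_arcs D' v. reorient D D' f e)"
    if "v \<in> mverts G" for v
    using f that by (metis (no_types, lifting) eq_iff_diff_eq_0 mflow_def)
  moreover have "\<bar>reorient D D' f e\<bar> = \<bar>f e\<bar>" for e
    by (simp add: reorient_def)
  moreover have "reorient D D' f e = 0" if "e \<notin> medges G" for e
    using f that by (simp add: mflow_def reorient_def)
  ultimately show ?thesis
    using f by (simp add: mflow_def)
qed

lemma flow_adjacent_reorient:
  assumes "multigraph G" "orientation G D" "orientation G D'" "flow_adjacent m G D f f'"
  shows "flow_adjacent m G D' (reorient D D' f) (reorient D D' f')"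
proof -
  have "\<forall>e\<in>A. reorient D D' f e = reorient D D' f' e" if "\<forall>e\<in>A. f e = f' e" for A
    using that by (simp add: reorient_def)
  then show ?thesis
    using assms mflow_reorient[OF assms(1-3)] unfolding flow_adjacent_def by blast
qed

lemma flow_connected_iff:
  assumes G: "multigraph G" and D: "orientation G D"
  shows "flow_connected m G \<longleftrightarrow>
    (\<forall>f f'. mflow m G D f \<and> mflow m G D f' \<longrightarrow> flow_equivalent m G D f f')"
    (is "_ \<longleftrightarrow> ?R")
proof
  show ?R if "flow_connected m G"
    using that D by (simp add: flow_connected_def)
  show "flow_connected m G" if R: ?R
    unfolding flow_connected_def
  proof (intro allI impI, elim conjE)
    fix D' f f'
    assume D': "orientation G D'" and f: "mflow m G D' f" and f': "mflow m G D' f'"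
    have "(flow_adjacent m G D)\<^sup>*\<^sup>* (reorient D' D f) (reorient D' D f')"
      using R mflow_reorient[OF G D' D] f f' by (simp add: flow_equivalent_def)
    then have "(flow_adjacent m G D')\<^sup>*\<^sup>*
        (reorient D D' (reorient D' D f)) (reorient D D' (reorient D' D f'))"
    proof (induction rule: rtranclp_induct)
      case base
      show ?case by (rule rtranclp.rtrancl_refl)
    next
      case (step g g')
      show ?case
        using step.IH flow_adjacent_reorient[OF G D D' step.hyps(2)]
        by - (rule rtranclp.rtrancl_into_rtrancl)
    qed
    then show "flow_equivalent m G D' f f'"
      using f f' by (simp add: flow_equivalent_def)
  qed
qed

end

theory Submission
  imports Defs
begin

text \<open>
  The intermediate objects are the flows all of whose values are odd.

  Every \<open>2k\<close>-flow \<open>f\<close> is equivalent to such a flow. By conservation, each vertex meets an even number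
  of edges with odd value, and since the graph is Eulerian it then also meets an even number of
  edges with even value. Hence, as long as some value is even, there is a cycle all of whose values
  are even, and pushing one unit around it makes all of them odd. No value leaves the permitted range: a
  nonzero even value \<open>x\<close> with \<open>\<bar>x\<bar> < 2k\<close> satisfies \<open>2 \<le> \<bar>x\<bar> \<le> 2k - 2\<close>.

  Any two odd flows \<open>f\<close>, \<open>f'\<close> are equivalent. The difference \<open>f' - f\<close> is an even circulation, so unless it is
  zero its support contains a cycle directed along it. Pushing two units around this cycle moves every
  value of \<open>f\<close> on it towards that of \<open>f'\<close> without overshooting, and keeps all values odd, hence
  nonzero.

  Both cycles are found in the same way, by a walk that can always be continued along a new edge
  (\<open>cycle_of_continuable_steps\<close>). The walks differ only in the steps allowed: all steps along
  even-valued edges in the first case, steps in the direction of \<open>f' - f\<close> in the second.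
\<close>

section \<open>Cycles from walks\<close>

text \<open>
  The walk is cut at its first repeated vertex. This makes the vertices distinct, and with them
  the edges: two equal edges would have to be consecutive, which is excluded.
\<close>

lemma closed_path_of_continuable_steps:
  fixes P :: "'v \<Rightarrow> 'e \<Rightarrow> 'v \<Rightarrow> bool"
  assumes fin: "finite V"
    and P: "\<And>u x w. P u x w \<Longrightarrow> u \<in> V"
    and ends: "\<And>u x w. P u x w \<Longrightarrow> E x = {u, w}"
    and cont: "\<And>u x w. P u x w \<Longrightarrow> \<exists>y z. P w y z \<and> y \<noteq> x"
    and start: "P u0 e0 w0"
  obtains v e n where "n > 0" "v n = v 0" "inj_on v {..<n}" "inj_on e {..<n::nat}"
    "\<And>i. i < n \<Longrightarrow> P (v i) (e i) (v (Suc i))"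
proof -
  define Q where "Q = (\<lambda>t. P (fst t) (fst (snd t)) (snd (snd t)))"
  have "\<exists>t. \<forall>n. Q (t n) \<and>
      (fst (t (Suc n)) = snd (snd (t n)) \<and> fst (snd (t (Suc n))) \<noteq> fst (snd (t n)))"
  proof (rule dependent_nat_choice)
    show "\<exists>t. Q t" using start by (auto simp: Q_def)
    fix t n assume "Q t"
    then show "\<exists>s. Q s \<and> (fst s = snd (snd t) \<and> fst (snd s) \<noteq> fst (snd t))"
      using cont unfolding Q_def by fastforce
  qed
  then obtain t where t: "\<And>n. Q (t n)" "\<And>n. fst (t (Suc n)) = snd (snd (t n))"
    "\<And>n. fst (snd (t (Suc n))) \<noteq> fst (snd (t n))" by blast
  define u where "u = (\<lambda>n. fst (t n))"
  define x where "x = (\<lambda>n. fst (snd (t n)))"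
  have step: "P (u n) (x n) (u (Suc n))" for n
    using t(1)[of n] t(2)[of n] by (simp add: u_def x_def Q_def)
  have new: "x (Suc n) \<noteq> x n" for n
    using t(3) by (simp add: x_def)
  have "range u \<subseteq> V" using step P by blast
  then have "\<not> inj u"
    using fin finite_subset range_inj_infinite by blast
  then obtain a b where "a < b" "u a = u b"
    by (metis injI linorder_neqE_nat)
  then have ex: "\<exists>j. \<exists>i<j. u i = u j" by blast
  define j where "j = (LEAST j. \<exists>i<j. u i = u j)"
  obtain i where i: "i < j" "u i = u j"
    using LeastI_ex[OF ex] unfolding j_def by blast
  have least: "\<not> (\<exists>a<b. u a = u b)" if "b < j" for b
    using not_less_Least that unfolding j_def by blast
  have dist: "u a \<noteq> u b" if "a < j" "b < j" "a \<noteq> b" for a b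
    using that least by (metis linorder_neqE_nat)
  have edist: "x a \<noteq> x b" if "a < b" "b < j" for a b
  proof
    assume eq: "x a = x b"
    then have "{u a, u (Suc a)} = {u b, u (Suc b)}"
      using ends[OF step] by metis
    then have "u (Suc a) = u b"
      using dist[of a b] that by (auto simp: doubleton_eq_iff)
    then have "Suc a = b"
      using dist[of "Suc a" b] that by force
    then show False using new[of a] eq by simp
  qed
  show ?thesis
  proof (rule that[of "j - i" "\<lambda>a. u (i + a)" "\<lambda>a. x (i + a)"])
    show "inj_on (\<lambda>a. u (i + a)) {..<j - i}"
      using dist[of "i + a" "i + b" for a b] unfolding inj_on_def
      by (metis add_left_cancel lessThan_iff less_diff_conv add.commute)
    show "inj_on (\<lambda>a. x (i + a)) {..<j - i}"
      by (rule linorder_inj_onI) (use edist in auto)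
  qed (use i step in auto)
qed

lemma mcycle_of_closed_path:
  assumes n: "n > 0" "v n = v 0" and inj: "inj_on v {..<n}" "inj_on e {..<n::nat}"
    and E: "\<And>i. i < n \<Longrightarrow> E (e i) = {v i, v (Suc i)}"
    and noloop: "\<And>i. i < n \<Longrightarrow> v i \<noteq> v (Suc i)"
  shows "mcycle \<lparr>mverts = v ` {..<n}, medges = e ` {..<n}, mends = E\<rparr>" (is "mcycle ?C")
proof -
  have vin: "v (Suc i) \<in> v ` {..<n}" if "i < n" for i
    using that n by (cases "Suc i = n") (auto intro: rev_image_eqI)
  have mg: "multigraph ?C"
    using E noloop vin by (auto simp: multigraph_def)
  have adj: "madjacent ?C (v i) (v (Suc i))" if "i < n" for i
    using E that by (auto simp: madjacent_def)
  have reach: "(madjacent ?C)\<^sup>*\<^sup>* (v 0) (v i)" if "i < n" for i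
    using that
  proof (induction i)
    case (Suc i)
    then show ?case using adj[of i] by (meson Suc_lessD rtranclp.rtrancl_into_rtrancl)
  qed simp
  have "symp (madjacent ?C)"
    by (auto simp: symp_def madjacent_def insert_commute)
  then have sym: "symp (madjacent ?C)\<^sup>*\<^sup>*"
    by (rule symp_rtranclp)
  have conn: "mconnected ?C"
    unfolding mconnected_def
  proof (intro conjI ballI)
    show "mverts ?C \<noteq> {}" using n by auto
    fix a b assume "a \<in> mverts ?C" "b \<in> mverts ?C"
    then show "(madjacent ?C)\<^sup>*\<^sup>* a b"
      using reach sym by (auto dest: sympD intro: rtranclp_trans)
  qed
  have "mdegree ?C (v i) = 2" if i: "i < n" for i
  proof -
    \<comment> \<open>the index before \<open>i\<close> in cyclic order; the other edge at \<open>v i\<close> is \<open>e p\<close>\<close>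
    define p where "p = (if i = 0 then n - 1 else i - 1)"
    have p: "p < n" "v (Suc p) = v i" using i n by (auto simp: p_def)
    have veq: "v a = v b \<longleftrightarrow> a = b" if "a < n" "b < n" for a b
      using inj(1) that by (auto dest: inj_onD)
    have "p \<noteq> i" using noloop[of i] p by auto
    have only: "j = i \<or> j = p" if j: "j < n" "v i \<in> E (e j)" for j
    proof -
      consider "v i = v j" | "v i = v (Suc j)" using E[OF j(1)] j(2) by auto
      then show ?thesis
      proof cases
        case 2
        show ?thesis
        proof (cases "Suc j = n")
          case True
          then show ?thesis using 2 n i veq[of i 0] by (auto simp: p_def)
        next
          case False
          then show ?thesis using 2 i j(1) veq[of i "Suc j"] by (auto simp: p_def)
        qed
      qed (use veq i j in auto)
    qed
    have "{x \<in> medges ?C. v i \<in> mends ?C x} = {e i, e p}"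
      using only i p E by auto
    moreover have "e i \<noteq> e p"
      using inj(2) i p(1) \<open>p \<noteq> i\<close> by (auto dest: inj_onD)
    ultimately show ?thesis by (simp add: mdegree_def)
  qed
  then show ?thesis
    using mg conn by (auto simp: mcycle_def)
qed

definition circulation ::
  "('v, 'e) pre_multigraph \<Rightarrow> ('v, 'e) pre_digraph \<Rightarrow> ('e \<Rightarrow> int) \<Rightarrow> bool" where
  "circulation G D g \<longleftrightarrow> (\<forall>v\<in>mverts G. (\<Sum>e\<in>out_arcs D v. g e) = (\<Sum>e\<in>in_arcs D v. g e))"

lemma net_outflow_eq_sum:
  fixes g :: "'e \<Rightarrow> int"
  assumes "multigraph G" "orientation G D"
  shows "(\<Sum>e\<in>out_arcs D v. g e) - (\<Sum>e\<in>in_arcs D v. g e) =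
    (\<Sum>e\<in>medges G. g e * (of_bool (tail D e = v) - of_bool (head D e = v)))"
proof -
  have "finite (medges G)" "arcs D = medges G"
    using assms by (auto simp: multigraph_def orientation_def)
  moreover have "g e * (of_bool (tail D e = v) - of_bool (head D e = v)) =
      (if tail D e = v then g e else 0) - (if head D e = v then g e else 0)" for e
    by simp
  ultimately show ?thesis
    by (simp add: out_arcs_def in_arcs_def sum_subtractf sum.inter_filter)
qed

lemma no_loop:
  assumes "multigraph G" "e \<in> medges G" "mends G e = {u, w}"
  shows "u \<noteq> w"
proof
  assume "u = w"
  then have "card (mends G e) = 1" using assms(3) by simp
  then show False using assms(1,2) by (simp add: multigraph_def)
qed

text \<open>
  Here \<open>P u x w\<close> says that the edge \<open>x\<close> may be traversed from \<open>u\<close> to \<open>w\<close>. If every permitted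
  step can be followed by a permitted step along a different edge, some cycle can be traversed by permitted
  steps, and \<open>c\<close> is the unit circulation around it in that direction.
\<close>

lemma cycle_of_continuable_steps:
  assumes G: "multigraph G" and D: "orientation G D"
    and edge: "\<And>u x w. P u x w \<Longrightarrow> x \<in> medges G \<and> mends G x = {u, w}"
    and cont: "\<And>u x w. P u x w \<Longrightarrow> \<exists>y z. P w y z \<and> y \<noteq> x"
    and start: "P u0 e0 w0"
  obtains C c where "msubgraph C G" "mcycle C" "medges C \<noteq> {}" "circulation G D c"
    "\<And>x. x \<notin> medges C \<Longrightarrow> c x = 0"
    "\<And>x. x \<in> medges C \<Longrightarrow>
      c x = 1 \<and> P (tail D x) x (head D x) \<or> c x = -1 \<and> P (head D x) x (tail D x)"
proof -
  have V: "mends G x \<subseteq> mverts G" if "x \<in> medges G" for x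
    using that G by (auto simp: multigraph_def)
  have "finite (mverts G)" using G by (simp add: multigraph_def)
  moreover have "u \<in> mverts G" "mends G x = {u, w}" if "P u x w" for u x w
    using edge[OF that] V by auto
  ultimately obtain v e n where path: "n > 0" "v n = v 0" "inj_on v {..<n}" "inj_on e {..<n::nat}"
    and step: "\<And>i. i < n \<Longrightarrow> P (v i) (e i) (v (Suc i))"
    by (rule closed_path_of_continuable_steps[where P = P and E = "mends G", OF _ _ _ cont start])
      blast+
  define C where "C = \<lparr>mverts = v ` {..<n}, medges = e ` {..<n}, mends = mends G\<rparr>"
  have cyc: "mcycle C"
    unfolding C_def using path edge[OF step] no_loop[OF G]
    by (intro mcycle_of_closed_path) blast+
  have sub: "msubgraph C G"
  proof -
    have "mverts C \<subseteq> mverts G" "medges C \<subseteq> medges G"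
      using edge[OF step] V by (auto simp: C_def)
    then show ?thesis using cyc by (auto simp: msubgraph_def mcycle_def C_def)
  qed
  \<comment> \<open>At most one summand is nonzero, since the edges \<open>e i\<close> are distinct.\<close>
  define c :: "'b \<Rightarrow> int" where
    "c = (\<lambda>x. \<Sum>i<n. of_bool (x = e i) * (if tail D x = v i then 1 else -1))"
  have c: "c (e i) = (if tail D (e i) = v i then 1 else -1)" if i: "i < n" for i
  proof -
    have "c (e i) = (\<Sum>j<n. if j = i then (if tail D (e i) = v i then 1 else -1) else 0)"
      unfolding c_def using i path(4)
      by (intro sum.cong) (auto dest: inj_onD)
    then show ?thesis using i by simp
  qed
  have dir: "c (e i) = 1 \<and> tail D (e i) = v i \<and> head D (e i) = v (Suc i) \<or>
      c (e i) = -1 \<and> tail D (e i) = v (Suc i) \<and> head D (e i) = v i" if "i < n" for i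
  proof -
    have "{tail D (e i), head D (e i)} = {v i, v (Suc i)}"
      using edge[OF step[OF that]] D by (auto simp: orientation_def)
    moreover have "v i \<noteq> v (Suc i)" using no_loop[OF G] edge[OF step[OF that]] by blast
    ultimately show ?thesis
      unfolding doubleton_eq_iff c[OF that] by (elim disjE conjE) simp_all
  qed
  have c0: "c x = 0" if "x \<notin> medges C" for x
    using that by (auto simp: c_def C_def intro!: sum.neutral)
  have "(\<Sum>x\<in>out_arcs D w. c x) - (\<Sum>x\<in>in_arcs D w. c x) = 0" for w
  proof -
    let ?h = "\<lambda>x. c x * (of_bool (tail D x = w) - of_bool (head D x = w))"
    have "(\<Sum>x\<in>medges G. ?h x) = (\<Sum>x\<in>medges C. ?h x)"
      using G sub c0 by (intro sum.mono_neutral_right) (auto simp: multigraph_def msubgraph_def)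
    also have "\<dots> = (\<Sum>i<n. ?h (e i))"
      using path(4) by (simp add: C_def sum.reindex)
    \<comment> \<open>Each step contributes at its start and end only, so the sum telescopes.\<close>
    also have "\<dots> = (\<Sum>i<n. of_bool (v i = w) - of_bool (v (Suc i) = w))"
    proof (rule sum.cong[OF refl])
      fix i assume "i \<in> {..<n}"
      then have "i < n" by simp
      from dir[OF this] show "?h (e i) = of_bool (v i = w) - of_bool (v (Suc i) = w)"
        by (elim disjE conjE) simp_all
    qed
    also have "\<dots> = 0"
      using sum_lessThan_telescope'[of "\<lambda>i. of_bool (v i = w) :: int" n] path(2) by simp
    finally show ?thesis by (simp add: net_outflow_eq_sum[OF G D])
  qed
  then have circ: "circulation G D c" by (simp add: circulation_def)
  show ?thesis
  proof (rule that[OF sub cyc _ circ c0])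
    show "medges C \<noteq> {}" using path(1) by (auto simp: C_def)
    fix x assume "x \<in> medges C"
    then obtain i where i: "i < n" "x = e i" by (auto simp: C_def)
    from dir[OF i(1)] step[OF i(1)]
    show "c x = 1 \<and> P (tail D x) x (head D x) \<or> c x = -1 \<and> P (head D x) x (tail D x)"
      unfolding i(2) by (elim disjE conjE) simp_all
  qed
qed

section \<open>Pushing flow around a cycle\<close>

lemma flow_adjacent_push:
  assumes f: "mflow m G D f" and C: "msubgraph C G" "mcycle C"
    and c: "circulation G D c" "\<And>x. x \<notin> medges C \<Longrightarrow> c x = 0"
    and bounds: "\<And>x. x \<in> medges C \<Longrightarrow> 0 < \<bar>f x + a * c x\<bar> \<and> \<bar>f x + a * c x\<bar> < int m"
  shows "flow_adjacent m G D f (\<lambda>x. f x + a * c x)"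
proof -
  have "0 < \<bar>f x + a * c x\<bar> \<and> \<bar>f x + a * c x\<bar> < int m" if "x \<in> medges G" for x
    using f c(2)[of x] bounds[of x] that by (cases "x \<in> medges C") (auto simp: mflow_def)
  moreover have "f x + a * c x = 0" if "x \<notin> medges G" for x
    using that f C(1) c(2)[of x] by (cases "x \<in> medges C") (auto simp: mflow_def msubgraph_def)
  ultimately have "mflow m G D (\<lambda>x. f x + a * c x)"
    using f c(1) by (simp add: mflow_def circulation_def sum.distrib flip: sum_distrib_left)
  then show ?thesis
    using f C c(2) unfolding flow_adjacent_def by auto
qed

lemma symp_flow_adjacent: "symp (flow_adjacent m G D)"
  by (auto simp: symp_def flow_adjacent_def)

section \<open>Making all values odd\<close>

text \<open>
  By conservation the values at \<open>v\<close>, summed without signs, give twice the outflow. Adding 1 to each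
  value changes the sum by the even degree of \<open>v\<close> and turns exactly the even values into odd ones, whose
  number has the parity of the sum.
\<close>

lemma even_card_even_valued_edges:
  fixes f :: "'e \<Rightarrow> int"
  assumes G: "multigraph G" "eulerian G" and D: "orientation G D"
    and f: "circulation G D f" and v: "v \<in> mverts G"
  shows "even (card {e \<in> medges G. v \<in> mends G e \<and> even (f e)})"
proof -
  define A where "A = {e \<in> medges G. v \<in> mends G e}"
  have fin: "finite (medges G)" "arcs D = medges G"
    using G D by (auto simp: multigraph_def orientation_def)
  then have "finite A" by (simp add: A_def)
  have A: "A = out_arcs D v \<union> in_arcs D v"
    using fin D by (auto simp: A_def orientation_def)
  have "tail D e \<noteq> head D e" if "e \<in> medges G" for e
    using no_loop[OF G(1) that] D that by (auto simp: orientation_def)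
  then have "out_arcs D v \<inter> in_arcs D v = {}"
    using fin by force
  then have "(\<Sum>e\<in>A. f e) = 2 * (\<Sum>e\<in>out_arcs D v. f e)"
    unfolding A using \<open>finite A\<close> f v by (simp add: A sum.union_disjoint circulation_def)
  moreover have "even (card A)"
    using G(2) v by (simp add: eulerian_def mdegree_def A_def)
  ultimately have "even (\<Sum>e\<in>A. f e + 1)"
    by (simp add: sum.distrib)
  then have "even (card {e \<in> A. odd (f e + 1)})"
    by (simp only: even_sum_iff[OF \<open>finite A\<close>])
  moreover have "{e \<in> A. odd (f e + 1)} = {e \<in> medges G. v \<in> mends G e \<and> even (f e)}"
    by (auto simp: A_def)
  ultimately show ?thesis by simp
qed

lemma reaches_odd_flow:
  assumes G: "multigraph G" "eulerian G" and D: "orientation G D"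
    and f: "mflow (2 * k) G D f"
  shows "\<exists>g. (flow_adjacent (2 * k) G D)\<^sup>*\<^sup>* f g \<and> mflow (2 * k) G D g \<and>
    (\<forall>e\<in>medges G. odd (g e))"
  using f
proof (induction "card {e \<in> medges G. even (f e)}" arbitrary: f rule: less_induct)
  case less
  show ?case
  proof (cases "\<forall>e\<in>medges G. odd (f e)")
    case True
    then show ?thesis using less.prems by blast
  next
    case False
    then obtain e0 where e0: "e0 \<in> medges G" "even (f e0)" by blast
    define P where "P = (\<lambda>u e w. e \<in> medges G \<and> even (f e) \<and> mends G e = {u, w})"
    have circ: "circulation G D f"
      using less.prems by (simp add: circulation_def mflow_def)
    have cont: "\<exists>y z. P w y z \<and> y \<noteq> x" if "P u x w" for u x w
    proof -
      define B where "B = {e \<in> medges G. w \<in> mends G e \<and> even (f e)}"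
      have x: "x \<in> B" "w \<in> mverts G"
        using that G(1) by (auto simp: P_def B_def multigraph_def)
      have "even (card B)"
        unfolding B_def by (rule even_card_even_valued_edges[OF G D circ x(2)])
      then have "B \<noteq> {x}" by auto
      then obtain y where y: "y \<in> B" "y \<noteq> x" using x by blast
      then have "w \<in> mends G y" "card (mends G y) = 2"
        using G(1) by (auto simp: B_def multigraph_def)
      then obtain a b where "mends G y = {a, b}" "w = a \<or> w = b"
        by (auto simp: card_2_iff)
      then obtain z where "mends G y = {w, z}" by (auto simp: insert_commute)
      then show ?thesis using y by (auto simp: P_def B_def)
    qed
    have start: "P (tail D e0) e0 (head D e0)"
      using e0 D by (auto simp: P_def orientation_def)
    have edge: "x \<in> medges G \<and> mends G x = {u, w}" if "P u x w" for u x w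
      using that by (simp add: P_def)
    obtain C c
      where C: "msubgraph C G" "mcycle C" "medges C \<noteq> {}" and c: "circulation G D c"
        "\<And>x. x \<notin> medges C \<Longrightarrow> c x = 0"
        and cP: "\<And>x. x \<in> medges C \<Longrightarrow>
          c x = 1 \<and> P (tail D x) x (head D x) \<or> c x = -1 \<and> P (head D x) x (tail D x)"
      by (rule cycle_of_continuable_steps[where P = P, OF G(1) D edge cont start]) blast+
    have CG: "medges C \<subseteq> medges G" using C by (simp add: msubgraph_def)
    have ev: "even (f x)" "c x = 1 \<or> c x = -1" if "x \<in> medges C" for x
      using cP[OF that] by (auto simp: P_def)
    let ?g = "\<lambda>x. f x + 1 * c x"
    have adj: "flow_adjacent (2 * k) G D f ?g"
    proof (rule flow_adjacent_push[OF less.prems C(1,2) c])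
      fix x assume x: "x \<in> medges C"
      have "0 < \<bar>f x\<bar> \<and> \<bar>f x\<bar> < 2 * int k"
        using less.prems x CG by (auto simp: mflow_def)
      moreover obtain y where y: "f x = 2 * y" using ev(1)[OF x] by blast
      ultimately have "y \<noteq> 0" "\<bar>y\<bar> < int k" by auto
      then show "0 < \<bar>f x + 1 * c x\<bar> \<and> \<bar>f x + 1 * c x\<bar> < int (2 * k)"
        using ev(2)[OF x] unfolding y by auto
    qed
    obtain x where x: "x \<in> medges C" using C(3) by blast
    have odd: "odd (?g y)" if "y \<in> medges C" for y
      using ev[OF that] by (elim disjE) simp_all
    have "even (f y)" if "even (?g y)" for y
      using odd[of y] c(2)[of y] that by (cases "y \<in> medges C") simp_all
    then have "{e \<in> medges G. even (?g e)} \<subseteq> {e \<in> medges G. even (f e)}" by blast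
    moreover have "x \<in> {e \<in> medges G. even (f e)} - {e \<in> medges G. even (?g e)}"
      using odd[OF x] ev(1)[OF x] CG x by blast
    ultimately have "{e \<in> medges G. even (?g e)} \<subset> {e \<in> medges G. even (f e)}" by blast
    then have fewer: "card {e \<in> medges G. even (?g e)} < card {e \<in> medges G. even (f e)}"
      using G(1) by (intro psubset_card_mono) (auto simp: multigraph_def)
    have "mflow (2 * k) G D ?g" using adj by (simp add: flow_adjacent_def)
    from less.hyps[OF fewer this] obtain h where h: "(flow_adjacent (2 * k) G D)\<^sup>*\<^sup>* ?g h"
      and odd_h: "mflow (2 * k) G D h" "\<forall>e\<in>medges G. odd (h e)"
      by (elim exE conjE)
    have "(flow_adjacent (2 * k) G D)\<^sup>*\<^sup>* f h"
      using adj h by (rule converse_rtranclp_into_rtranclp)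
    with odd_h show ?thesis by (intro exI[of _ h] conjI)
  qed
qed

section \<open>Connecting odd flows\<close>

text \<open>
  The relation \<open>P\<close> allows an edge to be traversed only in the direction in which \<open>g\<close> flows. If
  no such step left \<open>w\<close>, then no edge would carry flow out of \<open>w\<close>, whereas \<open>x\<close> carries a positive amount into
  it, against conservation.
\<close>

lemma circulation_positive_step_continues:
  assumes G: "multigraph G" and D: "orientation G D" and g: "circulation G D g"
    and P: "P = (\<lambda>u e w. e \<in> medges G \<and>
      (0 < g e \<and> u = tail D e \<and> w = head D e \<or> g e < 0 \<and> u = head D e \<and> w = tail D e))"
    and step: "P u x w"
  shows "\<exists>y z. P w y z \<and> y \<noteq> x"
proof (rule ccontr)
  assume none: "\<not> ?thesis"
  have ends: "mends G e = {tail D e, head D e}" "tail D e \<noteq> head D e" if "e \<in> medges G" for e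
    using no_loop[OF G that] D that by (auto simp: orientation_def)
  have fin: "finite (medges G)" "arcs D = medges G" "finite (arcs D)"
    using G D by (auto simp: multigraph_def orientation_def)
  have "y \<noteq> x" if "P w y z" for y z
    using that step ends(2)[of x] by (auto simp: P)
  then have no_exit: "\<not> P w y z" for y z
    using none by blast
  let ?h = "\<lambda>e. g e * (of_bool (tail D e = w) - of_bool (head D e = w))"
  have "?h e \<le> 0" if "e \<in> medges G" for e
    using no_exit[of e "head D e"] no_exit[of e "tail D e"] ends(2)[OF that] that
    by (auto simp: P)
  moreover have "?h x < 0" "x \<in> medges G"
    using step ends(2)[of x] by (auto simp: P)
  ultimately have "(\<Sum>e\<in>medges G. ?h e) < (\<Sum>e\<in>medges G. 0)"
    using fin(1) by (intro sum_strict_mono_ex1) blast+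
  moreover have "w \<in> mverts G"
    using step ends(1)[of x] G by (auto simp: P multigraph_def)
  then have "(\<Sum>e\<in>medges G. ?h e) = 0"
    using g net_outflow_eq_sum[OF G D, where v = w and g = g] by (simp add: circulation_def)
  ultimately show False by simp
qed

lemma odd_flows_equivalent:
  assumes G: "multigraph G" and D: "orientation G D"
    and f: "mflow m G D f" "\<forall>e\<in>medges G. odd (f e)"
    and f': "mflow m G D f'" "\<forall>e\<in>medges G. odd (f' e)"
  shows "(flow_adjacent m G D)\<^sup>*\<^sup>* f f'"
  using f
proof (induction "\<Sum>e\<in>medges G. nat \<bar>f' e - f e\<bar>" arbitrary: f rule: less_induct)
  case less
  define g where "g = (\<lambda>e. f' e - f e)"
  show ?case
  proof (cases "\<forall>e\<in>medges G. g e = 0")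
    case True
    then have "f e = f' e" for e
      using less.prems(1) f'(1) by (cases "e \<in> medges G") (auto simp: g_def mflow_def)
    then have "f = f'" by blast
    then show ?thesis by simp
  next
    case False
    then obtain e0 where e0: "e0 \<in> medges G" "g e0 \<noteq> 0" by blast
    have circ: "circulation G D g"
      using less.prems(1) f'(1) by (simp add: circulation_def mflow_def g_def sum_subtractf)
    define P where "P = (\<lambda>u e w. e \<in> medges G \<and>
      (0 < g e \<and> u = tail D e \<and> w = head D e \<or> g e < 0 \<and> u = head D e \<and> w = tail D e))"
    have edge: "x \<in> medges G \<and> mends G x = {u, w}" if "P u x w" for u x w
      using that D by (auto simp: P_def orientation_def)
    obtain u0 w0 where start: "P u0 e0 w0"
      using e0 unfolding P_def by (metis linorder_neqE_linordered_idom)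
    obtain C c where C: "msubgraph C G" "mcycle C" "medges C \<noteq> {}" and c: "circulation G D c"
      "\<And>x. x \<notin> medges C \<Longrightarrow> c x = 0"
      and cP: "\<And>x. x \<in> medges C \<Longrightarrow>
        c x = 1 \<and> P (tail D x) x (head D x) \<or> c x = -1 \<and> P (head D x) x (tail D x)"
      by (rule cycle_of_continuable_steps[where P = P, OF G D edge
            circulation_positive_step_continues[OF G D circ P_def] start]) blast+
    have CG: "medges C \<subseteq> medges G" using C by (simp add: msubgraph_def)
    \<comment> \<open>Values of equal parity that differ do so by at least 2, so adding \<open>2 * c x\<close> cannot overshoot.\<close>
    have tow: "c x = 1 \<and> f x + 2 \<le> f' x \<or> c x = -1 \<and> f' x \<le> f x - 2" if x: "x \<in> medges C" for x
    proof -
      have "tail D x \<noteq> head D x"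
        using no_loop[OF G, of x] D x CG by (auto simp: orientation_def)
      then have "c x = 1 \<and> f x < f' x \<or> c x = -1 \<and> f' x < f x"
        using cP[OF x] by (auto simp: P_def g_def)
      moreover have "odd (f x)" "odd (f' x)"
        using less.prems(2) f'(2) x CG by auto
      then have "f' x \<noteq> f x + 1" "f x \<noteq> f' x + 1" by auto
      ultimately show ?thesis by linarith
    qed
    let ?f = "\<lambda>x. f x + 2 * c x"
    have odd: "\<forall>e\<in>medges G. odd (?f e)" using less.prems(2) by simp
    have adj: "flow_adjacent m G D f ?f"
    proof (rule flow_adjacent_push[OF less.prems(1) C(1,2) c])
      fix x assume x: "x \<in> medges C"
      have "\<bar>f x\<bar> < int m" "\<bar>f' x\<bar> < int m"
        using less.prems(1) f'(1) x CG by (auto simp: mflow_def)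
      moreover have "?f x \<noteq> 0" using odd x CG by (metis even_zero subsetD)
      ultimately show "0 < \<bar>?f x\<bar> \<and> \<bar>?f x\<bar> < int m"
        using tow[OF x] by auto
    qed
    have closer: "nat \<bar>f' x - ?f x\<bar> < nat \<bar>f' x - f x\<bar>" if "x \<in> medges C" for x
      using tow[OF that] by auto
    have "nat \<bar>f' x - ?f x\<bar> \<le> nat \<bar>f' x - f x\<bar>" for x
      using closer[of x] c(2)[of x] by (cases "x \<in> medges C") auto
    then have decrease: "(\<Sum>e\<in>medges G. nat \<bar>f' e - ?f e\<bar>) < (\<Sum>e\<in>medges G. nat \<bar>f' e - f e\<bar>)"
      using G C(3) CG closer unfolding multigraph_def by (intro sum_strict_mono_ex1) blast+
    have "mflow m G D ?f" using adj by (simp add: flow_adjacent_def)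
    then have "(flow_adjacent m G D)\<^sup>*\<^sup>* ?f f'"
      by (rule less.hyps[OF decrease _ odd])
    with adj show ?thesis by (rule converse_rtranclp_into_rtranclp)
  qed
qed

theorem theorem4p2:
  fixes G :: "('v, 'e) pre_multigraph" and k :: nat
  assumes "multigraph G" and "eulerian G" and "k > 0"
  shows "flow_connected (2 * k) G"
  unfolding flow_connected_def flow_equivalent_def
proof (intro allI impI, elim conjE, intro conjI)
  fix D f f'
  assume D: "orientation G D" and f: "mflow (2 * k) G D f" and f': "mflow (2 * k) G D f'"
  let ?R = "(flow_adjacent (2 * k) G D)\<^sup>*\<^sup>*"
  obtain g where g: "?R f g" "mflow (2 * k) G D g" "\<forall>e\<in>medges G. odd (g e)"
    using reaches_odd_flow[OF assms(1,2) D f] by blast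
  obtain g' where g': "?R f' g'" "mflow (2 * k) G D g'" "\<forall>e\<in>medges G. odd (g' e)"
    using reaches_odd_flow[OF assms(1,2) D f'] by blast
  have "?R g g'" by (rule odd_flows_equivalent[OF assms(1) D g(2,3) g'(2,3)])
  moreover have "?R g' f'"
    using g'(1) symp_rtranclp[OF symp_flow_adjacent] by (blast dest: sympD)
  ultimately show "?R f f'" using g(1) by (meson rtranclp_trans)
qed

end
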